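(* Let $G_\bullet$ be a vertex-stable $\mathrm{FI}$-graph of stable degree $\leq d$. Then each of the functions $n \mapsto \Delta(G_n)$ and $n \mapsto \delta(G_n)$ agrees with a polynomial of degree at most $d$ for all $n \gg 0$.
   Context: Graphs are finite and simple (no multi-edges, no self-loops), possibly disconnected. A homomorphism of graphs $\phi:G\to G'$ is a map $V(G)\to V(G')$ such that $\{x,y\}\in E(G)$ implies $\{\phi(x),\phi(y)\}\in E(G')$. $\Delta(G)$ and $\delta(G)$ denote the maximum and minimum degree of a vertex of $G$ (with the convention that both are $0$ if $G$ has no vertices). Let $[n]=\{1,\dots,n\}$, and let $\mathrm{FI}$ be the category with objects $[n]$, $n\ge 0$, and morphisms all injections. An $\mathrm{FI}$-graph $G_\bullet$ is a functor from $\mathrm{FI}$ to the category of graphs and graph homomorphisms; $G_n$ is its value on $[n]$ and $G(f)$ is the map induced by an injection $f$. $G_\bullet$ is vertex-stable with stable degree $\le d$ if for all $n\ge d$ and every $v\in V(G_{n+1})$ there exist $w\in V(G_n)$ and an injection $f:[n]\hookrightarrow[n+1]$ with $G(f)(w)=v$. "For all $n\gg 0$" means for all sufficiently large $n$. The zero polynomial is regarded as having degree at most any bound. *)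

theory Defs
  imports "HOL-Library.FuncSet" "HOL-Computational_Algebra.Polynomial"
begin

record 'a sgraph =
  verts :: "'a set"
  edges :: "'a set set"

definition simple_graph :: "'a sgraph \<Rightarrow> bool" where
  "simple_graph G \<longleftrightarrow> finite (verts G) \<and> (\<forall>e\<in>edges G. e \<subseteq> verts G \<and> card e = 2)"

definition graph_hom :: "'a sgraph \<Rightarrow> 'b sgraph \<Rightarrow> ('a \<Rightarrow> 'b) \<Rightarrow> bool" where
  "graph_hom G H \<phi> \<longleftrightarrow> \<phi> \<in> verts G \<rightarrow> verts H \<and>
     (\<forall>x y. {x, y} \<in> edges G \<longrightarrow> {\<phi> x, \<phi> y} \<in> edges H)"

definition vdegree :: "'a sgraph \<Rightarrow> 'a \<Rightarrow> nat" where
  "vdegree G v = card {e \<in> edges G. v \<in> e}"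

definition max_degree :: "'a sgraph \<Rightarrow> nat" where
  "max_degree G = (if verts G = {} then 0 else Max (vdegree G ` verts G))"

definition min_degree :: "'a sgraph \<Rightarrow> nat" where
  "min_degree G = (if verts G = {} then 0 else Min (vdegree G ` verts G))"

text \<open>The morphisms of FI from \<open>[n]\<close> to \<open>[m]\<close>. They are extensional functions, so
  that two of them are equal as soon as they agree on \<open>[n]\<close>.\<close>

definition fi_hom :: "nat \<Rightarrow> nat \<Rightarrow> (nat \<Rightarrow> nat) set" where
  "fi_hom n m = {f \<in> {1..n} \<rightarrow>\<^sub>E {1..m}. inj_on f {1..n}}"

text \<open>A functor from FI to graphs: \<open>G n\<close> is its value on \<open>[n]\<close>, and \<open>act n m f\<close> is the map
  induced by \<open>f : [n] \<rightarrow> [m]\<close>, of which only the values on the vertices of \<open>G n\<close> matter.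
  As the graphs \<open>G n\<close> are finite, drawing all their vertices from one arbitrary type is no
  restriction; different \<open>G n\<close> may share vertices without any consequence.\<close>

locale fi_graph =
  fixes G :: "nat \<Rightarrow> 'a sgraph"
    and act :: "nat \<Rightarrow> nat \<Rightarrow> (nat \<Rightarrow> nat) \<Rightarrow> 'a \<Rightarrow> 'a"
  assumes simple: "simple_graph (G n)"
    and hom: "f \<in> fi_hom n m \<Longrightarrow> graph_hom (G n) (G m) (act n m f)"
    and act_id: "v \<in> verts (G n) \<Longrightarrow> act n n (\<lambda>i\<in>{1..n}. i) v = v"
    and act_compose: "\<lbrakk>f \<in> fi_hom l n; g \<in> fi_hom n m; v \<in> verts (G l)\<rbrakk>
      \<Longrightarrow> act l m (compose {1..l} g f) v = act n m g (act l n f v)"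

definition vertex_stable ::
    "(nat \<Rightarrow> 'a sgraph) \<Rightarrow> (nat \<Rightarrow> nat \<Rightarrow> (nat \<Rightarrow> nat) \<Rightarrow> 'a \<Rightarrow> 'a) \<Rightarrow> nat \<Rightarrow> bool" where
  "vertex_stable G act d \<longleftrightarrow> (\<forall>n\<ge>d. \<forall>v\<in>verts (G (n + 1)).
     \<exists>w\<in>verts (G n). \<exists>f\<in>fi_hom n (n + 1). act n (n + 1) f w = v)"

text \<open>Polynomials have rational coefficients, since integer-valued polynomials such as
  \<open>n (n - 1) / 2\<close> occur. The library convention \<open>degree 0 = 0\<close> makes the zero
  polynomial satisfy every degree bound.\<close>

definition eventually_poly :: "(nat \<Rightarrow> nat) \<Rightarrow> nat \<Rightarrow> bool" where
  "eventually_poly h d \<longleftrightarrow> (\<exists>p :: rat poly. degree p \<le> d \<and>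
     (\<forall>\<^sub>F n in sequentially. of_nat (h n) = poly p (of_nat n)))"

end

theory Submission
  imports Defs "HOL-Library.List_Lexorder" "HOL-Library.Product_Lexorder"
begin

text \<open>By stability every vertex of \<open>G n\<close> is the image of some \<open>w \<in> verts (G d)\<close> under an
  injection \<open>[d] \<rightarrow> [n]\<close>, and since the symmetric group acts transitively on these injections, its
  degree depends on \<open>w\<close> only. So it is enough to show that for each of the finitely many \<open>w\<close> the
  degree of its image under the inclusion is eventually a polynomial in \<open>n\<close>; finitely many
  polynomials are eventually totally ordered, which settles the maximum and the minimum.

  Every vertex of \<open>G (d + N)\<close> can be written as \<open>(y, l)\<close> with \<open>y \<in> verts (G (2 d))\<close> and \<open>l\<close> a strictly
  increasing sequence of length \<open>d\<close> below \<open>N\<close>, which encodes an order embedding \<open>[2 d] \<rightarrow> [d + N]\<close>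
  fixing \<open>[d]\<close>; the lexicographically least such pair makes the description unique. Being adjacent to
  the image of \<open>w\<close>, and being adjacent without being least, are both preserved by order embeddings that
  fix \<open>[d]\<close>. In terms of the gaps of \<open>l\<close>, sets of sequences preserved in this way are monomial ideals in
  \<open>d + 1\<close> variables, counted by total degree, so Dickson's lemma and the theorem on Hilbert polynomials
  give a polynomial of degree at most \<open>d\<close>.\<close>

subsection \<open>Eventually polynomial functions\<close>

definition ev_poly :: "(nat \<Rightarrow> rat) \<Rightarrow> nat \<Rightarrow> bool" where
  "ev_poly h d \<longleftrightarrow> (\<exists>p. degree p \<le> d \<and> (\<forall>\<^sub>F n in sequentially. h n = poly p (of_nat n)))"

lemma eventually_poly_iff: "eventually_poly h d \<longleftrightarrow> ev_poly (\<lambda>n. of_nat (h n)) d"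
  by (simp add: eventually_poly_def ev_poly_def)

lemma ev_poly_cong:
  assumes "\<forall>\<^sub>F n in sequentially. g n = h n" "ev_poly h d"
  shows "ev_poly g d"
proof -
  obtain p where p: "degree p \<le> d" "\<forall>\<^sub>F n in sequentially. h n = poly p (of_nat n)"
    using assms(2) by (auto simp: ev_poly_def)
  have "\<forall>\<^sub>F n in sequentially. g n = poly p (of_nat n)"
    using assms(1) p(2) by eventually_elim simp
  with p(1) show ?thesis by (auto simp: ev_poly_def)
qed

lemma ev_poly_const: "ev_poly (\<lambda>_. c) d"
  unfolding ev_poly_def by (intro exI[of _ "[:c:]"]) simp

lemma ev_poly_mono: "ev_poly h d \<Longrightarrow> d \<le> e \<Longrightarrow> ev_poly h e"
  unfolding ev_poly_def using order_trans by blast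

lemma ev_poly_add:
  assumes "ev_poly g d" "ev_poly h d"
  shows "ev_poly (\<lambda>n. g n + h n) d"
proof -
  obtain p q where pq: "degree p \<le> d" "\<forall>\<^sub>F n in sequentially. g n = poly p (of_nat n)"
    "degree q \<le> d" "\<forall>\<^sub>F n in sequentially. h n = poly q (of_nat n)"
    using assms by (auto simp: ev_poly_def)
  have "\<forall>\<^sub>F n in sequentially. g n + h n = poly (p + q) (of_nat n)"
    using pq(2,4) by eventually_elim simp
  with pq show ?thesis
    unfolding ev_poly_def by (intro exI[of _ "p + q"]) (auto intro: degree_add_le)
qed

lemma ev_poly_diff:
  assumes "ev_poly g d" "ev_poly h d"
  shows "ev_poly (\<lambda>n. g n - h n) d"
proof -
  obtain p q where pq: "degree p \<le> d" "\<forall>\<^sub>F n in sequentially. g n = poly p (of_nat n)"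
    "degree q \<le> d" "\<forall>\<^sub>F n in sequentially. h n = poly q (of_nat n)"
    using assms by (auto simp: ev_poly_def)
  have "\<forall>\<^sub>F n in sequentially. g n - h n = poly (p - q) (of_nat n)"
    using pq(2,4) by eventually_elim simp
  with pq show ?thesis
    unfolding ev_poly_def by (intro exI[of _ "p - q"]) (auto intro: degree_diff_le)
qed

lemma ev_poly_sum:
  assumes "\<And>i. i \<in> I \<Longrightarrow> ev_poly (h i) d"
  shows "ev_poly (\<lambda>n. \<Sum>i\<in>I. h i n) d"
  using assms by (induction I rule: infinite_finite_induct) (auto intro: ev_poly_const ev_poly_add)

lemma ev_poly_shift:
  assumes "ev_poly h d"
  shows "ev_poly (\<lambda>n. h (n - k)) d"
proof -
  obtain p where p: "degree p \<le> d" "\<forall>\<^sub>F n in sequentially. h n = poly p (of_nat n)"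
    using assms by (auto simp: ev_poly_def)
  \<comment> \<open>This is \<open>p(x - k)\<close>; truncated subtraction agrees with it once
    \<open>n\<close> is at least \<open>k\<close>.\<close>
  let ?q = "p \<circ>\<^sub>p [:- of_nat k, 1:]"
  have "\<forall>\<^sub>F n in sequentially. h (n - k) = poly p (of_nat (n - k))"
    using p(2) by (simp add: eventually_sequentially) (metis le_diff_conv2 add_leE)
  with eventually_ge_at_top[of k]
  have "\<forall>\<^sub>F n in sequentially. h (n - k) = poly ?q (of_nat n)"
    by eventually_elim (simp add: poly_pcompose of_nat_diff)
  moreover have "degree ?q \<le> d"
    using p(1) by (simp add: degree_pcompose)
  ultimately show ?thesis by (auto simp: ev_poly_def)
qed

section \<open>Summation and eventual comparison of polynomials\<close>

text \<open>Induction on the degree bound: the difference \<open>D\<close> of the monomial of degree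
  \<open>d + 2\<close> has degree \<open>d + 1\<close> and leading coefficient \<open>d + 2\<close>,
  so subtracting a suitable multiple of \<open>D\<close> removes the top coefficient of
  \<open>p\<close>.\<close>

lemma poly_antidifference:
  fixes p :: "rat poly"
  assumes "degree p \<le> d"
  shows "\<exists>q. degree q \<le> Suc d \<and> (\<forall>x. poly q (x + 1) - poly q x = poly p x)"
  using assms
proof (induction d arbitrary: p)
  case 0
  then obtain c where "p = [:c:]" by (metis degree_eq_zeroE le_zero_eq)
  then show ?case by (intro exI[of _ "[:0, c:]"]) (simp add: algebra_simps)
next
  case (Suc d)
  define m :: "rat poly" where "m = monom 1 (Suc (Suc d))"
  define D where "D = [:1, 1:] ^ Suc (Suc d) - m"
  define c where "c = coeff p (Suc d) / of_nat (Suc (Suc d))"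
  define r where "r = p - smult c D"
  have poly_D: "poly D x = poly m (x + 1) - poly m x" for x
    by (simp add: D_def m_def poly_monom add.commute del: power_Suc)
  have coeff_D: "coeff D k = (if k \<le> Suc d then of_nat (Suc (Suc d) choose k) else 0)" for k
  proof -
    have "coeff ([:1, 1::rat:] ^ Suc (Suc d)) k = 0" if "k > Suc (Suc d)"
      using that by (intro coeff_eq_0) (simp only: degree_linear_power)
    then show ?thesis
      using coeff_linear_poly_power[of k "Suc (Suc d)" "1::rat" 1]
      by (cases k "Suc (Suc d)" rule: linorder_cases)
        (simp_all add: D_def m_def del: power_Suc binomial_Suc_Suc)
  qed
  have "coeff r k = 0" if "k > d" for k
  proof (cases "k = Suc d")
    case True
    then show ?thesis by (simp add: r_def coeff_D c_def)
  next
    case False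
    with that have "k > Suc d" by simp
    with Suc.prems show ?thesis by (simp add: r_def coeff_D coeff_eq_0)
  qed
  then have "degree r \<le> d" by (intro degree_le) auto
  from Suc.IH[OF this] obtain q where q: "degree q \<le> Suc d"
    "\<And>x. poly q (x + 1) - poly q x = poly r x" by blast
  have "poly (q + smult c m) (x + 1) - poly (q + smult c m) x = poly p x" for x
    using q(2)[of x] by (simp add: r_def poly_D algebra_simps)
  moreover have "degree (q + smult c m) \<le> Suc (Suc d)"
    using q(1) degree_monom_le[of "1::rat" "Suc (Suc d)"]
    by (intro degree_add_le order_trans[OF degree_smult_le]) (auto simp: m_def)
  ultimately show ?case by blast
qed

lemma ev_poly_sum_lessThan:
  assumes "ev_poly h d"
  shows "ev_poly (\<lambda>n. \<Sum>t<n. h t) (Suc d)"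
proof -
  obtain p N where p: "degree p \<le> d" "\<And>n. n \<ge> N \<Longrightarrow> h n = poly p (of_nat n)"
    using assms by (auto simp: ev_poly_def eventually_sequentially)
  obtain q where q: "degree q \<le> Suc d" "\<And>x. poly q (x + 1) - poly q x = poly p x"
    using poly_antidifference[OF p(1)] by blast
  \<comment> \<open>The finitely many values before \<open>N\<close>, where \<open>h\<close> need
    not follow \<open>p\<close>, are absorbed into a constant; from \<open>N\<close> on the sum
    telescopes.\<close>
  define c where "c = (\<Sum>t<N. h t) - poly q (of_nat N)"
  have "(\<Sum>t<n. h t) = poly (q + [:c:]) (of_nat n)" if "n \<ge> N" for n
    using that
  proof (induction n rule: dec_induct)
    case base
    then show ?case by (simp add: c_def)
  next
    case (step n)
    then show ?case using p(2)[of n] q(2)[of "of_nat n"]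
      by (simp add: algebra_simps)
  qed
  moreover have "degree (q + [:c:]) \<le> Suc d"
    using q(1) by (intro degree_add_le) auto
  ultimately show ?thesis
    unfolding ev_poly_def eventually_sequentially by blast
qed

text \<open>A uniform bound \<open>c > 0\<close>, rather than mere positivity, lets the induction
  over coefficients go through: multiplied by \<open>n\<close>, it outgrows any constant
  term.\<close>

lemma poly_eventually_pos:
  fixes p :: "rat poly"
  assumes "lead_coeff p > 0"
  shows "\<exists>c>0. \<forall>\<^sub>F n in sequentially. poly p (of_nat n) \<ge> c"
  using assms
proof (induction p)
  case 0
  then show ?case by simp
next
  case (pCons a p)
  show ?case
  proof (cases "p = 0")
    case True
    with pCons.prems show ?thesis by (intro exI[of _ a]) simp
  next
    case False
    with pCons obtain c where c: "c > 0" "\<forall>\<^sub>F n in sequentially. poly p (of_nat n) \<ge> c"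
      by auto
    obtain N :: nat where N: "of_nat N \<ge> (1 + \<bar>a\<bar>) / c"
      using real_arch_simple by blast
    have "\<forall>\<^sub>F n in sequentially. poly (pCons a p) (of_nat n) \<ge> 1"
      using c(2) eventually_ge_at_top[of N]
    proof eventually_elim
      case (elim n)
      have "1 + \<bar>a\<bar> \<le> of_nat N * c" using N c(1) by (simp add: field_simps)
      also have "\<dots> \<le> of_nat n * poly p (of_nat n)"
        using elim c(1) by (intro mult_mono) auto
      finally show ?case by simp
    qed
    then show ?thesis by (intro exI[of _ 1]) simp
  qed
qed

lemma ev_poly_comparable:
  assumes "ev_poly g d" "ev_poly h d"
  shows "(\<forall>\<^sub>F n in sequentially. g n \<le> h n) \<or> (\<forall>\<^sub>F n in sequentially. h n \<le> g n)"
proof -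
  obtain p where p: "\<forall>\<^sub>F n in sequentially. h n - g n = poly p (of_nat n)"
    using ev_poly_diff[OF assms(2,1)] by (auto simp: ev_poly_def)
  consider "p = 0" | "lead_coeff p > 0" | "lead_coeff (- p) > 0"
    by (cases "lead_coeff p" "0::rat" rule: linorder_cases) auto
  then show ?thesis
  proof cases
    case 1
    with p have "\<forall>\<^sub>F n in sequentially. g n \<le> h n" by (auto elim: eventually_mono)
    then show ?thesis ..
  next
    case 2
    then obtain c where "c > 0" "\<forall>\<^sub>F n in sequentially. poly p (of_nat n) \<ge> c"
      using poly_eventually_pos by blast
    with p have "\<forall>\<^sub>F n in sequentially. g n \<le> h n"
      by (auto elim: eventually_elim2)
    then show ?thesis ..
  next
    case 3
    then obtain c where "c > 0" "\<forall>\<^sub>F n in sequentially. poly (- p) (of_nat n) \<ge> c"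
      using poly_eventually_pos by blast
    with p have "\<forall>\<^sub>F n in sequentially. h n \<le> g n"
      by (auto elim: eventually_elim2)
    then show ?thesis ..
  qed
qed

lemma eventually_poly_max_min:
  assumes "eventually_poly g d" "eventually_poly h d"
  shows "eventually_poly (\<lambda>n. max (g n) (h n)) d" "eventually_poly (\<lambda>n. min (g n) (h n)) d"
proof -
  have *: "ev_poly (\<lambda>n. of_nat (g n)) d" "ev_poly (\<lambda>n. of_nat (h n)) d"
    using assms by (auto simp: eventually_poly_iff)
  from ev_poly_comparable[OF *]
  consider "\<forall>\<^sub>F n in sequentially. g n \<le> h n" | "\<forall>\<^sub>F n in sequentially. h n \<le> g n" by auto
  then have "ev_poly (\<lambda>n. of_nat (max (g n) (h n))) d \<and> ev_poly (\<lambda>n. of_nat (min (g n) (h n))) d"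
  proof cases
    case 1
    then show ?thesis
      by (intro conjI ev_poly_cong[OF _ *(2)] ev_poly_cong[OF _ *(1)])
        (auto elim!: eventually_mono simp: max_def min_def)
  next
    case 2
    then show ?thesis
      by (intro conjI ev_poly_cong[OF _ *(1)] ev_poly_cong[OF _ *(2)])
        (auto elim!: eventually_mono simp: max_def min_def)
  qed
  then show "eventually_poly (\<lambda>n. max (g n) (h n)) d" "eventually_poly (\<lambda>n. min (g n) (h n)) d"
    by (auto simp: eventually_poly_iff)
qed

lemma eventually_poly_Max_Min:
  assumes "finite I" "I \<noteq> {}" "\<And>i. i \<in> I \<Longrightarrow> eventually_poly (h i) d"
  shows "eventually_poly (\<lambda>n. Max ((\<lambda>i. h i n) ` I)) d \<and>
    eventually_poly (\<lambda>n. Min ((\<lambda>i. h i n) ` I)) d"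
  using assms by (induction I rule: finite_ne_induct) (simp_all add: eventually_poly_max_min)

lemma eventually_poly_cong:
  assumes "\<forall>\<^sub>F n in sequentially. g n = h n" "eventually_poly h d"
  shows "eventually_poly g d"
  using assms(2) unfolding eventually_poly_iff
  by (rule ev_poly_cong[rotated]) (use assms(1) in \<open>auto elim: eventually_mono\<close>)

subsection \<open>Families of increasing sequences closed under order embeddings\<close>

text \<open>The diagonal stabilizes at some \<open>N\<close>, which by monotonicity makes
  \<open>A\<close> constant on the quadrant \<open>i, a \<ge> N\<close>. Only the finitely many
  columns \<open>a < N\<close> remain, and each stabilizes separately.\<close>

lemma double_chain_stabilizes:
  fixes A :: "nat \<Rightarrow> nat \<Rightarrow> 'b::order"
  assumes mono: "\<And>i i' a a'. i \<le> i' \<Longrightarrow> a \<le> a' \<Longrightarrow> A i a \<le> A i' a'"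
    and Q: "\<And>i a. Q (A i a)"
    and acc: "\<And>C :: nat \<Rightarrow> 'b. mono C \<Longrightarrow> (\<And>i. Q (C i)) \<Longrightarrow> \<exists>I. \<forall>i\<ge>I. C i = C I"
  shows "\<exists>I. \<forall>i\<ge>I. A i = A I"
proof -
  have "\<exists>I. \<forall>i\<ge>I. A i i = A I I"
    using acc[of "\<lambda>i. A i i"] by (auto simp: monoI mono Q)
  then obtain N where N: "\<And>i. i \<ge> N \<Longrightarrow> A i i = A N N" by blast
  have big: "A i a = A N N" if "i \<ge> N" "a \<ge> N" for i a
  proof (rule antisym)
    show "A i a \<le> A N N"
      using mono[of i "max i a" a "max i a"] N[of "max i a"] that by simp
    show "A N N \<le> A i a" using mono that by simp
  qed
  have "\<forall>a. \<exists>I. \<forall>i\<ge>I. A i a = A I a"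
  proof
    show "\<exists>I. \<forall>i\<ge>I. A i a = A I a" for a
      using acc[of "\<lambda>i. A i a"] by (auto simp: monoI mono Q)
  qed
  then obtain J where J: "\<And>a i. i \<ge> J a \<Longrightarrow> A i a = A (J a) a" by metis
  define I where "I = Max (insert N (J ` {..<N}))"
  have I: "I \<ge> N" "\<And>a. a < N \<Longrightarrow> I \<ge> J a" by (auto simp: I_def)
  have "A i a = A I a" if "i \<ge> I" for i a
  proof (cases "a < N")
    case True
    then show ?thesis using J[of a i] J[of a I] I(2)[of a] that by simp
  next
    case False
    then show ?thesis using big[of i a] big[of I a] I(1) that by simp
  qed
  then show ?thesis by blast
qed

section \<open>Increasing lists as monomials, and their slices\<close>

definition inc_lists :: "nat \<Rightarrow> nat \<Rightarrow> nat list set" where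
  "inc_lists k N = {l. length l = k \<and> sorted_wrt (<) l \<and> set l \<subseteq> {..<N}}"

text \<open>The coface maps; together they generate all order embeddings of initial segments.\<close>

definition skip :: "nat \<Rightarrow> nat \<Rightarrow> nat" where
  "skip i j = (if j < i then j else Suc j)"

text \<open>A list in \<open>inc_lists k N\<close> is a monomial of degree \<open>N - k\<close> in
  \<open>k + 1\<close> variables, its exponents being the gap lengths. \<open>skip i\<close> inserts
  a position at \<open>i\<close>, which multiplies by the variable of one gap; \<open>i = N\<close>
  leaves the list unchanged but enlarges the last gap. Closed families are thus monomial
  ideals.\<close>

definition skip_closed :: "nat \<Rightarrow> (nat \<Rightarrow> nat list set) \<Rightarrow> bool" where
  "skip_closed k U \<longleftrightarrow> (\<forall>N. U N \<subseteq> inc_lists k N) \<and>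
     (\<forall>N i l. i \<le> N \<longrightarrow> l \<in> U N \<longrightarrow> map (skip i) l \<in> U (Suc N))"

text \<open>Fixing the first entry \<open>a\<close> fixes the exponent of the first variable. The
  tail is renumbered from 0, so that slices are families with one variable fewer.\<close>

definition slice :: "nat \<Rightarrow> (nat \<Rightarrow> nat list set) \<Rightarrow> nat \<Rightarrow> nat \<Rightarrow> nat list set" where
  "slice k U a N = {l \<in> inc_lists k N. a # map ((+) (Suc a)) l \<in> U (Suc a + N)}"

lemma finite_inc_lists: "finite (inc_lists k N)"
  by (rule finite_subset[OF _ finite_lists_length_eq[of "{..<N}" k]]) (auto simp: inc_lists_def)

lemma strict_mono_skip: "strict_mono (skip i)"
  by (auto simp: strict_mono_def skip_def)

lemma map_strict_mono_inc_lists: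
  assumes "l \<in> inc_lists k N" "strict_mono f" "\<And>j. j < N \<Longrightarrow> f j < M"
  shows "map f l \<in> inc_lists k M"
  using assms by (auto simp: inc_lists_def sorted_wrt_map strict_mono_less)

lemma map_skip_inc_lists: "l \<in> inc_lists k N \<Longrightarrow> map (skip i) l \<in> inc_lists k (Suc N)"
  by (rule map_strict_mono_inc_lists) (auto simp: strict_mono_skip skip_def)

lemma inc_lists_0 [simp]: "inc_lists 0 N = {[]}"
  by (auto simp: inc_lists_def)

lemma inc_lists_Suc:
  "inc_lists (Suc k) N = (\<Union>a<N. (\<lambda>l. a # map ((+) (Suc a)) l) ` inc_lists k (N - Suc a))"
proof (intro equalityI subsetI)
  fix l assume l: "l \<in> inc_lists (Suc k) N"
  then obtain a l' where [simp]: "l = a # l'" and k: "length l' = k"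
    by (auto simp: inc_lists_def length_Suc_conv)
  have s: "sorted_wrt (<) l'" "\<forall>x\<in>set l'. a < x \<and> x < N" and a: "a < N"
    using l by (auto simp: inc_lists_def)
  define l'' where "l'' = map (\<lambda>x. x - Suc a) l'"
  have "map ((+) (Suc a)) l'' = map (\<lambda>x. x) l'"
    unfolding l''_def map_map by (rule map_cong) (use s in auto)
  moreover have "l'' \<in> inc_lists k (N - Suc a)"
  proof -
    have "sorted_wrt (\<lambda>x y. x - Suc a < y - Suc a) l'"
      using s(1) by (rule sorted_wrt_mono_rel[rotated]) (use s(2) in \<open>auto intro: diff_less_mono\<close>)
    then show ?thesis
      using s(2) k a by (auto simp: inc_lists_def l''_def sorted_wrt_map intro!: diff_less_mono)
  qed
  ultimately show "l \<in> (\<Union>a<N. (\<lambda>l. a # map ((+) (Suc a)) l) ` inc_lists k (N - Suc a))"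
    using a by (auto intro!: bexI[of _ a] image_eqI[of _ _ l''])
next
  fix l assume "l \<in> (\<Union>a<N. (\<lambda>l. a # map ((+) (Suc a)) l) ` inc_lists k (N - Suc a))"
  then show "l \<in> inc_lists (Suc k) N"
    by (fastforce simp: inc_lists_def sorted_wrt_map)
qed

lemma skip_closedD:
  assumes "skip_closed k U"
  shows "U N \<subseteq> inc_lists k N" "i \<le> N \<Longrightarrow> l \<in> U N \<Longrightarrow> map (skip i) l \<in> U (Suc N)"
  using assms by (auto simp: skip_closed_def)

text \<open>Skipping at \<open>Suc a + i\<close> fixes the first entry \<open>a\<close> and acts on
  the renumbered tail as \<open>skip i\<close>.\<close>

lemma skip_closed_slice:
  assumes "skip_closed (Suc k) U"
  shows "skip_closed k (slice k U a)"
  unfolding skip_closed_def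
proof (intro conjI allI impI)
  fix N i l assume i: "i \<le> N" and l: "l \<in> slice k U a N"
  have "map (skip (Suc a + i)) (a # map ((+) (Suc a)) l) \<in> U (Suc (Suc a + N))"
    using l i by (intro skip_closedD(2)[OF assms]) (auto simp: slice_def)
  moreover have "skip (Suc a + i) a = a" by (simp add: skip_def)
  moreover have "skip (Suc a + i) \<circ> (+) (Suc a) = (+) (Suc a) \<circ> skip i"
    by (auto simp: skip_def)
  ultimately have "a # map ((+) (Suc a)) (map (skip i) l) \<in> U (Suc (Suc a + N))"
    by simp
  then show "map (skip i) l \<in> slice k U a (Suc N)"
    using l by (auto simp: slice_def map_skip_inc_lists)
qed (auto simp: slice_def)

lemma slice_mono:
  assumes "skip_closed (Suc k) U" "\<And>N. U N \<subseteq> U' N" "a \<le> a'"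
  shows "slice k U a \<le> slice k U' a'"
proof -
  \<comment> \<open>Skipping 0 multiplies by the first variable: the first entry becomes
    \<open>Suc a\<close> and the renumbered tail stays the same.\<close>
  have "slice k U a \<le> slice k U (Suc a)" for a
  proof (intro le_funI subsetI)
    fix N l assume l: "l \<in> slice k U a N"
    have "map (skip 0) (a # map ((+) (Suc a)) l) \<in> U (Suc (Suc a + N))"
      using l by (intro skip_closedD(2)[OF assms(1)]) (auto simp: slice_def)
    moreover have "skip 0 = Suc" by (auto simp: skip_def)
    moreover have "Suc \<circ> (+) (Suc a) = (+) (Suc (Suc a))" by auto
    ultimately show "l \<in> slice k U (Suc a) N" using l by (simp add: slice_def)
  qed
  then have "slice k U a \<le> slice k U a'" using assms(3) by (rule lift_Suc_mono_le)
  also have "\<dots> \<le> slice k U' a'" using assms(2) by (auto simp: slice_def le_fun_def)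
  finally show ?thesis .
qed

lemma eq_if_slices_eq:
  assumes "skip_closed (Suc k) U" "skip_closed (Suc k) U'" "slice k U = slice k U'"
  shows "U = U'"
proof -
  have "U N \<subseteq> U' N" if U: "skip_closed (Suc k) U" and eq: "slice k U = slice k U'" for U U' N
  proof
    fix l assume l: "l \<in> U N"
    then obtain a l' where l': "a < N" "l = a # map ((+) (Suc a)) l'" "l' \<in> inc_lists k (N - Suc a)"
      using skip_closedD(1)[OF U, of N] by (auto simp: inc_lists_Suc)
    then have "l' \<in> slice k U a (N - Suc a)" using l by (simp add: slice_def)
    then have "l' \<in> slice k U' a (N - Suc a)" using eq by simp
    then show "l \<in> U' N" using l' by (simp add: slice_def)
  qed
  then show ?thesis using assms by (intro ext) (metis subset_antisym)
qed

text \<open>Dickson's lemma, as an ascending chain condition.\<close>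

lemma skip_closed_chain_stabilizes:
  fixes C :: "nat \<Rightarrow> nat \<Rightarrow> nat list set"
  assumes "mono C" "\<And>i. skip_closed k (C i)"
  shows "\<exists>I. \<forall>i\<ge>I. C i = C I"
  using assms
proof (induction k arbitrary: C)
  case 0
  \<comment> \<open>Without entries a family is just a truth value for each \<open>N\<close>,
    increasing in \<open>N\<close> by closure under \<open>skip 0\<close>.\<close>
  define A :: "nat \<Rightarrow> nat \<Rightarrow> bool" where "A i N = ([] \<in> C i N)" for i N
  have C: "C i N = (if A i N then {[]} else {})" for i N
    using skip_closedD(1)[OF 0(2), of i N] by (auto simp: A_def)
  have "\<exists>I. \<forall>i\<ge>I. A i = A I"
  proof (rule double_chain_stabilizes[where A = A and Q = "\<lambda>_. True"])
    fix i i' a a' :: nat assume "i \<le> i'" "a \<le> a'"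
    have "C i a \<subseteq> C i a'"
    proof (rule lift_Suc_mono_le[OF _ \<open>a \<le> a'\<close>])
      show "C i n \<subseteq> C i (Suc n)" for n
        using skip_closedD(2)[OF 0(2), of 0 n "[]" i] C[of i n] by (auto split: if_splits)
    qed
    also have "\<dots> \<subseteq> C i' a'" using monoD[OF 0(1) \<open>i \<le> i'\<close>] by (simp add: le_fun_def)
    finally show "A i a \<le> A i' a'" by (auto simp: A_def)
  next
    fix C :: "nat \<Rightarrow> bool" assume C: "mono C"
    show "\<exists>I. \<forall>i\<ge>I. C i = C I"
    proof (cases "\<exists>I. C I")
      case True
      then obtain I where "C I" ..
      then have "C i" if "i \<ge> I" for i using monoD[OF C that] by simp
      with \<open>C I\<close> show ?thesis by blast
    qed auto
  qed auto
  then obtain I where I: "\<And>i. i \<ge> I \<Longrightarrow> A i = A I" by blast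
  have "C i = C I" if "i \<ge> I" for i
    using I[OF that] by (intro ext) (simp add: C)
  then show ?case by blast
next
  case (Suc k)
  \<comment> \<open>The slices increase both in \<open>i\<close> and in \<open>a\<close>, and the
    induction hypothesis is the chain condition for families with one entry fewer.\<close>
  have "\<exists>I. \<forall>i\<ge>I. slice k (C i) = slice k (C I)"
  proof (rule double_chain_stabilizes[where A = "\<lambda>i. slice k (C i)" and Q = "skip_closed k"])
    show "slice k (C i) a \<le> slice k (C i') a'" if "i \<le> i'" "a \<le> a'" for i i' a a'
      using that monoD[OF Suc.prems(1)] by (intro slice_mono Suc.prems) (auto simp: le_fun_def)
  qed (auto intro: skip_closed_slice Suc)
  then obtain I where "\<And>i. i \<ge> I \<Longrightarrow> slice k (C i) = slice k (C I)" by auto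
  then show ?case using Suc.prems(2) eq_if_slices_eq by blast
qed

lemma card_eq_sum_slices:
  assumes "skip_closed (Suc k) U"
  shows "card (U N) = (\<Sum>a<N. card (slice k U a (N - Suc a)))"
proof -
  let ?f = "\<lambda>a l. a # map ((+) (Suc a)) l"
  have inj: "inj_on (?f a) X" for a X
    by (auto simp: inj_on_def)
  have "U N = (\<Union>a<N. ?f a ` slice k U a (N - Suc a))"
    using skip_closedD(1)[OF assms, of N] by (fastforce simp: inc_lists_Suc slice_def)
  also have "card \<dots> = (\<Sum>a<N. card (?f a ` slice k U a (N - Suc a)))"
    by (rule card_UN_disjoint) (auto simp: slice_def finite_inc_lists)
  finally show ?thesis by (simp only: card_image[OF inj])
qed

text \<open>The Hilbert polynomial argument: the slices are constant from some \<open>A\<close> on.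
  Slices before \<open>A\<close> contribute finitely many shifted functions of degree at most
  \<open>k\<close>; the others contribute partial sums of a single such function, which raises the
  degree bound by one.\<close>

lemma ev_poly_card_skip_closed:
  assumes "skip_closed k U"
  shows "ev_poly (\<lambda>N. of_nat (card (U N))) k"
  using assms
proof (induction k arbitrary: U)
  case 0
  have sub: "U N \<subseteq> {[]}" for N using skip_closedD(1)[OF 0] by simp
  show ?case
  proof (cases "\<exists>N. [] \<in> U N")
    case True
    then obtain M where M: "[] \<in> U M" by blast
    have "U N = {[]}" if "N \<ge> M" for N
      using that
    proof (induction N rule: dec_induct)
      case base
      then show ?case using M sub[of M] by auto
    next
      case (step N)
      then show ?case using skip_closedD(2)[OF 0, of 0 N "[]"] sub[of "Suc N"] by auto
    qed
    then have "\<forall>\<^sub>F N in sequentially. of_nat (card (U N)) = (1::rat)"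
      by (intro eventually_mono[OF eventually_ge_at_top[of M]]) simp
    then show ?thesis by (rule ev_poly_cong) (rule ev_poly_const)
  next
    case False
    then have "U N = {}" for N using sub[of N] by auto
    then show ?thesis by (simp add: ev_poly_const)
  qed
next
  case (Suc k)
  obtain A where A: "\<And>a. a \<ge> A \<Longrightarrow> slice k U a = slice k U A"
    using skip_closed_chain_stabilizes[of "slice k U" k]
      slice_mono[OF Suc.prems order_refl] skip_closed_slice[OF Suc.prems]
    by (auto simp: monoI)
  let ?h = "\<lambda>a N. of_nat (card (slice k U a N)) :: rat"
  have h: "ev_poly (?h a) k" for a
    by (intro Suc.IH skip_closed_slice Suc.prems)
  have eq: "of_nat (card (U N)) = (\<Sum>a<A. ?h a (N - Suc a)) + (\<Sum>t<N - A. ?h A t)" if "N \<ge> A" for N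
  proof -
    have "{..<N} = {..<A} \<union> {A..<N}" "{..<A} \<inter> {A..<N} = {}" using that by auto
    then have "of_nat (card (U N)) = (\<Sum>a<A. ?h a (N - Suc a)) + (\<Sum>a\<in>{A..<N}. ?h a (N - Suc a))"
      by (simp add: card_eq_sum_slices[OF Suc.prems] sum.union_disjoint)
    also have "(\<Sum>a\<in>{A..<N}. ?h a (N - Suc a)) = (\<Sum>a\<in>{A..<N}. ?h A (N - Suc a))"
    proof (rule sum.cong)
      show "?h a (N - Suc a) = ?h A (N - Suc a)" if "a \<in> {A..<N}" for a
        using A[of a] that by simp
    qed simp
    \<comment> \<open>Reindexing by \<open>t = N - Suc a\<close>, the number of positions above the
      first entry.\<close>
    also have "\<dots> = (\<Sum>t<N - A. ?h A t)"
      by (rule sum.reindex_bij_witness[of _ "\<lambda>t. N - Suc t" "\<lambda>a. N - Suc a"]) auto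
    finally show ?thesis .
  qed
  show ?case
  proof (rule ev_poly_cong)
    show "\<forall>\<^sub>F N in sequentially. of_nat (card (U N)) =
        (\<Sum>a<A. ?h a (N - Suc a)) + (\<Sum>t<N - A. ?h A t)"
      using eventually_ge_at_top[of A] by eventually_elim (rule eq)
    show "ev_poly (\<lambda>N. (\<Sum>a<A. ?h a (N - Suc a)) + (\<Sum>t<N - A. ?h A t)) (Suc k)"
      by (intro ev_poly_add ev_poly_sum ev_poly_mono[OF ev_poly_shift[OF h]]
          ev_poly_shift[OF ev_poly_sum_lessThan[OF h]]) simp
  qed
qed

text \<open>Lists are ordered lexicographically, and a strictly monotone map keeps the first
  difference in place with the same sign.\<close>

lemma map_strict_mono_less:
  fixes l l' :: "nat list"
  assumes "strict_mono f" "l < l'"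
  shows "map f l < map f l'"
  using assms(2)
proof (induction l arbitrary: l')
  case Nil
  then show ?case by (cases l') auto
next
  case (Cons a l)
  then show ?case using assms(1) by (cases l') (auto simp: strict_mono_less)
qed

subsection \<open>Graphs and FI-morphisms\<close>

definition nbrs :: "'a sgraph \<Rightarrow> 'a \<Rightarrow> 'a set" where
  "nbrs H v = {u. {v, u} \<in> edges H}"

lemma edge_verts:
  assumes "simple_graph H" "{x, y} \<in> edges H"
  shows "x \<in> verts H" "y \<in> verts H"
  using assms by (auto simp: simple_graph_def)

lemma finite_nbrs: "simple_graph H \<Longrightarrow> finite (nbrs H v)"
  by (rule finite_subset[of _ "verts H"]) (auto simp: nbrs_def simple_graph_def)

lemma vdegree_eq_card_nbrs:
  assumes "simple_graph H"
  shows "vdegree H v = card (nbrs H v)"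
proof -
  have "{e \<in> edges H. v \<in> e} \<subseteq> (\<lambda>u. {v, u}) ` nbrs H v"
  proof
    fix e assume e: "e \<in> {e \<in> edges H. v \<in> e}"
    then have "card e = 2" using assms by (auto simp: simple_graph_def)
    then obtain a b where "e = {a, b}" by (auto simp: card_2_iff)
    then have "e = {v, a} \<or> e = {v, b}" using e by auto
    then show "e \<in> (\<lambda>u. {v, u}) ` nbrs H v" using e by (auto simp: nbrs_def)
  qed
  then have "{e \<in> edges H. v \<in> e} = (\<lambda>u. {v, u}) ` nbrs H v"
    by (auto simp: nbrs_def)
  moreover have "inj_on (\<lambda>u. {v, u}) (nbrs H v)"
    by (auto simp: inj_on_def doubleton_eq_iff)
  ultimately show ?thesis by (simp add: vdegree_def card_image)
qed

section \<open>Permutations and transitivity\<close>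

lemma compose_fi_hom:
  assumes "f \<in> fi_hom l n" "g \<in> fi_hom n m"
  shows "compose {1..l} g f \<in> fi_hom l m"
proof -
  have f: "f \<in> {1..l} \<rightarrow> {1..n}" "inj_on f {1..l}" and g: "g \<in> {1..n} \<rightarrow> {1..m}" "inj_on g {1..n}"
    using assms by (simp_all add: fi_hom_def PiE_def)
  have "inj_on (compose {1..l} g f) {1..l}"
    using comp_inj_on[OF f(2) inj_on_subset[OF g(2)]] f(1)
    by (simp add: compose_def inj_on_restrict_eq comp_def image_subset_iff_funcset)
  with funcset_compose[OF f(1) g(1)] show ?thesis by (simp add: fi_hom_def PiE_def)
qed

lemma restrict_bij_fi_hom:
  assumes "bij_betw h {1..n} {1..n}"
  shows "restrict h {1..n} \<in> fi_hom n n"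
  using bij_betw_imp_inj_on[OF assms] bij_betw_apply[OF assms]
  by (simp add: fi_hom_def inj_on_restrict_eq)

lemma fi_hom_left_inverse:
  assumes "\<tau> \<in> fi_hom n n"
  shows "\<exists>\<sigma>\<in>fi_hom n n. compose {1..n} \<sigma> \<tau> = (\<lambda>i\<in>{1..n}. i)"
proof -
  have inj: "inj_on \<tau> {1..n}" and sub: "\<tau> ` {1..n} \<subseteq> {1..n}"
    using assms by (auto simp: fi_hom_def)
  then have bij: "bij_betw \<tau> {1..n} {1..n}"
    by (simp add: bij_betw_def endo_inj_surj)
  define \<sigma> where "\<sigma> = restrict (inv_into {1..n} \<tau>) {1..n}"
  have "bij_betw (inv_into {1..n} \<tau>) {1..n} {1..n}"
    using bij by (rule bij_betw_inv_into)
  then have "\<sigma> \<in> fi_hom n n"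
    unfolding \<sigma>_def by (rule restrict_bij_fi_hom)
  moreover have "compose {1..n} \<sigma> \<tau> = (\<lambda>i\<in>{1..n}. i)"
  proof (intro ext)
    show "compose {1..n} \<sigma> \<tau> i = (\<lambda>i\<in>{1..n}. i) i" for i
      using inj sub by (cases "i \<in> {1..n}") (auto simp: \<sigma>_def compose_def image_subset_iff)
  qed
  ultimately show ?thesis by blast
qed

text \<open>The complements of the two images have the same size, so a bijection \<open>h\<close>
  between them extends \<open>f i \<mapsto> g i\<close> to a permutation.\<close>

lemma fi_hom_transitive:
  assumes "f \<in> fi_hom k n" "g \<in> fi_hom k n"
  shows "\<exists>\<tau>\<in>fi_hom n n. compose {1..k} \<tau> f = g"
proof -
  let ?F = "f ` {1..k}" and ?H = "g ` {1..k}"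
  have f: "inj_on f {1..k}" "?F \<subseteq> {1..n}" and g: "inj_on g {1..k}" "?H \<subseteq> {1..n}"
    using assms by (auto simp: fi_hom_def)
  have "card ({1..n} - ?F) = card ({1..n} - ?H)"
    using f g by (simp add: card_Diff_subset card_image)
  then obtain h where h: "bij_betw h ({1..n} - ?F) ({1..n} - ?H)"
    using finite_same_card_bij by blast
  define \<tau> where "\<tau> = (\<lambda>i\<in>{1..n}. if i \<in> ?F then g (inv_into {1..k} f i) else h i)"
  have "bij_betw (\<lambda>i. g (inv_into {1..k} f i)) ?F ?H"
    using bij_betw_trans[OF bij_betw_inv_into[OF inj_on_imp_bij_betw[OF f(1)]]
        inj_on_imp_bij_betw[OF g(1)]] by (simp add: comp_def)
  then have "bij_betw (\<lambda>i. if i \<in> ?F then g (inv_into {1..k} f i) else h i)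
      (?F \<union> ({1..n} - ?F)) (?H \<union> ({1..n} - ?H))"
    using h by (intro bij_betw_disjoint_Un) auto
  moreover have "?F \<union> ({1..n} - ?F) = {1..n}" "?H \<union> ({1..n} - ?H) = {1..n}"
    using f(2) g(2) by auto
  ultimately have "\<tau> \<in> fi_hom n n"
    unfolding \<tau>_def by (intro restrict_bij_fi_hom) simp
  moreover have "compose {1..k} \<tau> f = g"
  proof
    fix i
    show "compose {1..k} \<tau> f i = g i"
    proof (cases "i \<in> {1..k}")
      case True
      then have "f i \<in> {1..n}" using f(2) by blast
      then show ?thesis using True f(1) by (simp add: compose_def \<tau>_def)
    next
      case False
      then show ?thesis using assms(2) by (auto simp: compose_def fi_hom_def PiE_def extensional_def)
    qed
  qed
  ultimately show ?thesis by blast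
qed

section \<open>Order embeddings fixing \<open>[d]\<close>, and factorization through them\<close>

text \<open>The extension by the identity on \<open>[d]\<close> of a map \<open>\<phi>\<close> between initial segments of the
  naturals, where \<open>j\<close> stands for the element \<open>d + 1 + j\<close> of \<open>[n]\<close>.\<close>

definition lift_map :: "nat \<Rightarrow> nat \<Rightarrow> (nat \<Rightarrow> nat) \<Rightarrow> nat \<Rightarrow> nat" where
  "lift_map d n \<phi> = (\<lambda>i\<in>{1..n}. if i \<le> d then i else Suc d + \<phi> (i - Suc d))"

lemma lift_map_fi_hom:
  assumes "d \<le> m" "inj_on \<phi> {..<n - d}" "\<phi> ` {..<n - d} \<subseteq> {..<m - d}"
  shows "lift_map d n \<phi> \<in> fi_hom n m"
proof -
  have le: "Suc d + \<phi> (i - Suc d) \<le> m" if "i \<in> {1..n}" "\<not> i \<le> d" for i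
  proof -
    have "\<phi> (i - Suc d) \<in> {..<m - d}" using that by (intro subsetD[OF assms(3)]) auto
    then show ?thesis by auto
  qed
  have "i = j" if "i \<in> {1..n}" "\<not> i \<le> d" "j \<in> {1..n}" "\<not> j \<le> d"
    "\<phi> (i - Suc d) = \<phi> (j - Suc d)" for i j
  proof -
    have "i - Suc d = j - Suc d" using that by (intro inj_onD[OF assms(2) that(5)]) auto
    then show ?thesis using that(2,4) by linarith
  qed
  moreover have "Suc d + \<phi> (i - Suc d) \<noteq> j" if "j \<le> d" for i j
    using that by simp
  ultimately have "inj_on (\<lambda>i. if i \<le> d then i else Suc d + \<phi> (i - Suc d)) {1..n}"
    by (intro inj_onI) (metis add_left_cancel)
  moreover have "lift_map d n \<phi> \<in> {1..n} \<rightarrow>\<^sub>E {1..m}"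
    unfolding lift_map_def using le assms(1) by (intro restrict_PiE_iff[THEN iffD2] ballI) auto
  ultimately show ?thesis by (simp add: fi_hom_def lift_map_def inj_on_restrict_eq)
qed

lemma compose_lift_map:
  assumes "d \<le> n" "\<psi> ` {..<k - d} \<subseteq> {..<n - d}"
  shows "compose {1..k} (lift_map d n \<phi>) (lift_map d k \<psi>) = lift_map d k (\<phi> \<circ> \<psi>)"
proof
  fix i
  have "\<psi> (i - Suc d) \<in> {..<n - d}" if "i \<in> {1..k}" "\<not> i \<le> d"
    using that by (intro subsetD[OF assms(2)]) auto
  then show "compose {1..k} (lift_map d n \<phi>) (lift_map d k \<psi>) i = lift_map d k (\<phi> \<circ> \<psi>) i"
    using assms(1) by (auto simp: compose_def lift_map_def)
qed

lemma lift_map_cong: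
  "(\<And>j. j < n - d \<Longrightarrow> \<phi> j = \<psi> j) \<Longrightarrow> lift_map d n \<phi> = lift_map d n \<psi>"
  by (auto simp: lift_map_def fun_eq_iff)

lemma lift_nth_fi_hom:
  assumes "l \<in> inc_lists k N"
  shows "lift_map d (d + k) ((!) l) \<in> fi_hom (d + k) (d + N)"
proof (rule lift_map_fi_hom)
  show "inj_on ((!) l) {..<d + k - d}"
    using assms by (auto simp: inc_lists_def strict_sorted_iff intro!: inj_on_nth)
  show "(!) l ` {..<d + k - d} \<subseteq> {..<d + N - d}"
    using assms by (auto simp: inc_lists_def dest: nth_mem)
qed simp

lemma lift_skip_fi_hom: "lift_map d (d + N) (skip i) \<in> fi_hom (d + N) (d + Suc N)"
  by (rule lift_map_fi_hom) (auto simp: skip_def inj_on_def)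

lemma compose_lift_skip_nth:
  assumes "l \<in> inc_lists k N"
  shows "compose {1..d + k} (lift_map d (d + N) (skip i)) (lift_map d (d + k) ((!) l)) =
    lift_map d (d + k) ((!) (map (skip i) l))"
proof (subst compose_lift_map)
  show "(!) l ` {..<d + k - d} \<subseteq> {..<d + N - d}"
    using assms by (auto simp: inc_lists_def dest: nth_mem)
  show "lift_map d (d + k) (skip i \<circ> (!) l) = lift_map d (d + k) ((!) (map (skip i) l))"
    using assms by (intro lift_map_cong) (auto simp: inc_lists_def)
qed simp

lemma incl_fi_hom: "d \<le> n \<Longrightarrow> lift_map d d id \<in> fi_hom d n"
  by (rule lift_map_fi_hom) auto

lemma compose_lift_skip_incl:
  "compose {1..d} (lift_map d (d + N) (skip i)) (lift_map d d id) = lift_map d d id"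
  by (subst compose_lift_map) (auto intro: lift_map_cong)

text \<open>At most \<open>d\<close> values of \<open>g\<close> lie outside \<open>[d]\<close>. An
  order embedding of \<open>[2 d]\<close> that fixes \<open>[d]\<close> and hits these values
  carries all dependence on \<open>N\<close>; \<open>g0\<close> records only their ranks.\<close>

lemma fi_hom_factor:
  assumes "g \<in> fi_hom d (d + N)" "d \<le> N"
  shows "\<exists>l\<in>inc_lists d N. \<exists>g0\<in>fi_hom d (d + d).
    compose {1..d} (lift_map d (d + d) ((!) l)) g0 = g"
proof -
  have g: "g \<in> {1..d} \<rightarrow>\<^sub>E {1..d + N}" "inj_on g {1..d}"
    using assms(1) by (auto simp: fi_hom_def)
  define M0 where "M0 = (\<lambda>i. g i - Suc d) ` {i \<in> {1..d}. d < g i}"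
  have "card M0 \<le> card {i \<in> {1..d}. d < g i}"
    unfolding M0_def by (rule card_image_le) simp
  also have "\<dots> \<le> card {1..d}" by (rule card_mono) auto
  finally have "card M0 \<le> d" by simp
  moreover have gle: "g i \<le> d + N" "1 \<le> g i" if "i \<in> {1..d}" for i
    using PiE_mem[OF g(1) that] by auto
  then have "M0 \<subseteq> {..<N}"
    unfolding M0_def by fastforce
  \<comment> \<open>The shifted outside values are padded to exactly \<open>d\<close> elements, so
    that \<open>l\<close> always has length \<open>d\<close>; \<open>d \<le> N\<close> provides the
    room.\<close>
  ultimately obtain M where M: "M0 \<subseteq> M" "M \<subseteq> {..<N}" "card M = d"
    using exists_subset_between[of M0 d "{..<N}"] assms(2) by auto
  have "finite M" using M(2) finite_subset by blast
  define l where "l = sorted_list_of_set M"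
  have l: "set l = M" "length l = d" "sorted_wrt (<) l"
    using \<open>finite M\<close> M(3) by (auto simp: l_def)
  then have "\<forall>z\<in>M. \<exists>j<d. l ! j = z" by (metis in_set_conv_nth)
  then obtain ix where ix: "\<And>z. z \<in> M \<Longrightarrow> ix z < d \<and> l ! ix z = z" by metis
  define g0 where "g0 = (\<lambda>i\<in>{1..d}. if g i \<le> d then g i else Suc d + ix (g i - Suc d))"
  have mem: "g i - Suc d \<in> M" if "i \<in> {1..d}" "\<not> g i \<le> d" for i
    using that M(1) by (auto simp: M0_def)
  have g0: "g0 \<in> {1..d} \<rightarrow>\<^sub>E {1..d + d}"
    using gle(2) ix[OF mem] by (fastforce simp: g0_def Suc_le_eq)
  have comp: "compose {1..d} (lift_map d (d + d) ((!) l)) g0 = g"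
  proof
    fix i
    show "compose {1..d} (lift_map d (d + d) ((!) l)) g0 i = g i"
    proof (cases "i \<in> {1..d}")
      case True
      then show ?thesis
        using gle[OF True] ix[OF mem[OF True]] by (auto simp: compose_def lift_map_def g0_def)
    next
      case False
      then show ?thesis using g(1) by (auto simp: compose_def PiE_def extensional_def)
    qed
  qed
  \<comment> \<open>Injectivity is inherited from \<open>g\<close>, which factors through
    \<open>g0\<close>.\<close>
  have "inj_on g0 {1..d}"
  proof (rule inj_onI)
    fix i j assume ij: "i \<in> {1..d}" "j \<in> {1..d}" "g0 i = g0 j"
    then have "g i = g j" unfolding comp[symmetric] by (simp add: compose_def)
    then show "i = j" using ij g(2) by (auto dest: inj_onD)
  qed
  with g0 have "g0 \<in> fi_hom d (d + d)" by (simp add: fi_hom_def)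
  moreover have "l \<in> inc_lists d N" using l M(2) by (simp add: inc_lists_def)
  ultimately show ?thesis using comp by blast
qed

subsection \<open>Vertex degrees of FI-graphs\<close>

context fi_graph
begin

lemma act_verts: "f \<in> fi_hom n m \<Longrightarrow> v \<in> verts (G n) \<Longrightarrow> act n m f v \<in> verts (G m)"
  using hom by (auto simp: graph_hom_def)

lemma act_edge: "f \<in> fi_hom n m \<Longrightarrow> {x, y} \<in> edges (G n) \<Longrightarrow> {act n m f x, act n m f y} \<in> edges (G m)"
  using hom by (auto simp: graph_hom_def)

lemma generated:
  assumes "vertex_stable G act d" "d \<le> n" "u \<in> verts (G n)"
  shows "\<exists>x\<in>verts (G d). \<exists>f\<in>fi_hom d n. act d n f x = u"
  using assms(2,3)
proof (induction n arbitrary: u rule: dec_induct)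
  case base
  then show ?case
    using act_id[of u d] restrict_bij_fi_hom[of "\<lambda>i. i" d]
    by (intro bexI[of _ u] bexI[of _ "\<lambda>i\<in>{1..d}. i"]) (simp_all add: bij_betw_def del: restrict_apply)
next
  case (step n)
  then obtain v f where v: "v \<in> verts (G n)" "f \<in> fi_hom n (Suc n)" "act n (Suc n) f v = u"
    using assms(1) unfolding vertex_stable_def by fastforce
  with step.IH obtain x g where x: "x \<in> verts (G d)" "g \<in> fi_hom d n" "act d n g x = v" by blast
  have "act d (Suc n) (compose {1..d} f g) x = u"
    using act_compose[OF x(2) v(2) x(1)] v(3) x(3) by simp
  then show ?case using x(1) compose_fi_hom[OF x(2) v(2)] by blast
qed

text \<open>A permutation carrying \<open>f\<close> to \<open>g\<close> acts injectively on
  vertices, having a left inverse in the action, and so embeds one neighbourhood into the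
  other.\<close>

lemma vdegree_act_le:
  assumes "f \<in> fi_hom k n" "g \<in> fi_hom k n" "w \<in> verts (G k)"
  shows "vdegree (G n) (act k n f w) \<le> vdegree (G n) (act k n g w)"
proof -
  obtain \<tau> where \<tau>: "\<tau> \<in> fi_hom n n" "compose {1..k} \<tau> f = g"
    using fi_hom_transitive[OF assms(1,2)] by blast
  obtain \<sigma> where \<sigma>: "\<sigma> \<in> fi_hom n n" "compose {1..n} \<sigma> \<tau> = (\<lambda>i\<in>{1..n}. i)"
    using fi_hom_left_inverse[OF \<tau>(1)] by blast
  have "act n n \<sigma> (act n n \<tau> v) = v" if "v \<in> verts (G n)" for v
    using act_compose[OF \<tau>(1) \<sigma>(1) that] \<sigma>(2) act_id[OF that] by simp
  then have "inj_on (act n n \<tau>) (verts (G n))" by (rule inj_on_inverseI)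
  then have "inj_on (act n n \<tau>) (nbrs (G n) (act k n f w))"
    by (rule inj_on_subset) (auto simp: nbrs_def dest: edge_verts[OF simple])
  moreover have "act k n g w = act n n \<tau> (act k n f w)"
    using act_compose[OF assms(1) \<tau>(1) assms(3)] \<tau>(2) by simp
  then have "act n n \<tau> ` nbrs (G n) (act k n f w) \<subseteq> nbrs (G n) (act k n g w)"
    using act_edge[OF \<tau>(1)] by (auto simp: nbrs_def)
  ultimately show ?thesis
    unfolding vdegree_eq_card_nbrs[OF simple] by (rule card_inj_on_le) (rule finite_nbrs[OF simple])
qed

lemma vdegree_act_eq:
  assumes "f \<in> fi_hom k n" "g \<in> fi_hom k n" "w \<in> verts (G k)"
  shows "vdegree (G n) (act k n f w) = vdegree (G n) (act k n g w)"
  using vdegree_act_le[OF assms] vdegree_act_le[OF assms(2,1,3)] by simp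

text \<open>Level \<open>d + d\<close> has room for \<open>[d]\<close> and for up to
  \<open>d\<close> values outside it, so that embeddings fixing \<open>[d]\<close> reach every
  vertex when \<open>N\<close> is at least \<open>d\<close>.\<close>

definition rep :: "nat \<Rightarrow> nat \<Rightarrow> 'a \<Rightarrow> nat list \<Rightarrow> 'a" where
  "rep d N y l = act (d + d) (d + N) (lift_map d (d + d) ((!) l)) y"

lemma rep_surj:
  assumes "vertex_stable G act d" "d \<le> N" "u \<in> verts (G (d + N))"
  shows "\<exists>y\<in>verts (G (d + d)). \<exists>l\<in>inc_lists d N. rep d N y l = u"
proof -
  obtain x g where x: "x \<in> verts (G d)" "g \<in> fi_hom d (d + N)" "act d (d + N) g x = u"
    using generated[OF assms(1) _ assms(3)] by auto
  obtain l g0 where l: "l \<in> inc_lists d N" "g0 \<in> fi_hom d (d + d)"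
    "compose {1..d} (lift_map d (d + d) ((!) l)) g0 = g"
    using fi_hom_factor[OF x(2) assms(2)] by blast
  have "rep d N (act d (d + d) g0 x) l = u"
    unfolding rep_def using act_compose[OF l(2) lift_nth_fi_hom[OF l(1)] x(1)] l(3) x(3) by simp
  then show ?thesis using l(1) act_verts[OF l(2) x(1)] by blast
qed

lemma rep_map_skip:
  assumes "y \<in> verts (G (d + d))" "l \<in> inc_lists d N"
  shows "rep d (Suc N) y (map (skip i) l) =
    act (d + N) (d + Suc N) (lift_map d (d + N) (skip i)) (rep d N y l)"
  using act_compose[OF lift_nth_fi_hom[OF assms(2)] lift_skip_fi_hom assms(1), of i]
  by (simp only: rep_def compose_lift_skip_nth[OF assms(2)])

lemma eventually_poly_vdegree:
  assumes stable: "vertex_stable G act d" and w: "w \<in> verts (G d)"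
  shows "eventually_poly (\<lambda>n. vdegree (G n) (act d n (lift_map d d id) w)) d"
proof -
  let ?V = "verts (G (d + d))"
  have finV: "finite ?V" using simple by (simp add: simple_graph_def)
  \<comment> \<open>An arbitrary numbering of the vertices breaks ties between descriptions with the
    same list.\<close>
  obtain idx :: "'a \<Rightarrow> nat" where idx: "inj_on idx ?V"
    using finite_imp_inj_to_nat_seg[OF finV] by blast
  define v where "v N = act d (d + N) (lift_map d d id) w" for N
  define Adj where "Adj y N = {l \<in> inc_lists d N. {v N, rep d N y l} \<in> edges (G (d + N))}" for y N
  \<comment> \<open>\<open>Adj y N - Bad y N\<close> holds the sequences of the lexicographically least descriptions of neighbours.\<close>
  define Bad where "Bad y N = {l \<in> Adj y N. \<exists>y'\<in>?V. \<exists>l'\<in>inc_lists d N.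
    rep d N y' l' = rep d N y l \<and> (l', idx y') < (l, idx y)}" for y N
  \<comment> \<open>The lifted \<open>skip i\<close> fixes \<open>[d]\<close>, hence carries one
    inclusion of \<open>[d]\<close> to the next.\<close>
  have v_Suc: "act (d + N) (d + Suc N) (lift_map d (d + N) (skip i)) (v N) = v (Suc N)" for N i
    unfolding v_def
    using act_compose[OF incl_fi_hom[of d "d + N"] lift_skip_fi_hom w] compose_lift_skip_incl by simp
  have Adj: "skip_closed d (Adj y)" if "y \<in> ?V" for y
    unfolding skip_closed_def
  proof (intro conjI allI impI)
    fix N i l assume l: "l \<in> Adj y N"
    then have "{v N, rep d N y l} \<in> edges (G (d + N))" "l \<in> inc_lists d N"
      by (auto simp: Adj_def)
    then have "{v (Suc N), rep d (Suc N) y (map (skip i) l)} \<in> edges (G (d + Suc N))"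
      using act_edge[OF lift_skip_fi_hom, of "v N" "rep d N y l" d N i]
      by (simp only: v_Suc rep_map_skip[OF that])
    then show "map (skip i) l \<in> Adj y (Suc N)"
      using l by (simp add: Adj_def map_skip_inc_lists)
  qed (auto simp: Adj_def)
  have Bad: "skip_closed d (Bad y)" if y: "y \<in> ?V" for y
    unfolding skip_closed_def
  proof (intro conjI allI impI)
    fix N i l assume i: "i \<le> N" and l: "l \<in> Bad y N"
    then obtain y' l' where y': "y' \<in> ?V" "l' \<in> inc_lists d N" "rep d N y' l' = rep d N y l"
      "(l', idx y') < (l, idx y)"
      by (auto simp: Bad_def)
    have "l \<in> Adj y N" using l by (simp add: Bad_def)
    then have Al: "map (skip i) l \<in> Adj y (Suc N)" and "l \<in> inc_lists d N"
      using skip_closedD(2)[OF Adj[OF y] i] by (auto simp: Adj_def)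
    then have "rep d (Suc N) y' (map (skip i) l') = rep d (Suc N) y (map (skip i) l)"
      using y' y by (simp add: rep_map_skip)
    \<comment> \<open>The smaller description is moved along the same \<open>skip i\<close>:
      distinct lists keep their order, and equal lists keep the tie-break by
      \<open>idx\<close>.\<close>
    moreover have "(map (skip i) l', idx y') < (map (skip i) l, idx y)"
    proof (cases "l' < l")
      case True
      then show ?thesis using map_strict_mono_less[OF strict_mono_skip] by auto
    next
      case False
      with y'(4) show ?thesis by auto
    qed
    ultimately show "map (skip i) l \<in> Bad y (Suc N)"
      unfolding Bad_def using Al y'(1) map_skip_inc_lists[OF y'(2)] by blast
  qed (auto simp: Bad_def Adj_def)
  have deg: "of_nat (vdegree (G (d + N)) (v N)) =
      (\<Sum>y\<in>?V. of_nat (card (Adj y N)) - of_nat (card (Bad y N)) :: rat)" if N: "d \<le> N" for N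
  proof -
    let ?S = "SIGMA y:?V. Adj y N - Bad y N"
    \<comment> \<open>Of two least descriptions of one vertex neither is smaller, so they coincide
      by totality of the order and injectivity of \<open>idx\<close>.\<close>
    have inj: "inj_on (\<lambda>(y, l). rep d N y l) ?S"
    proof (rule inj_onI, clarify)
      fix y l y' l'
      assume *: "y \<in> ?V" "l \<in> Adj y N" "l \<notin> Bad y N" "y' \<in> ?V" "l' \<in> Adj y' N" "l' \<notin> Bad y' N"
        "rep d N y l = rep d N y' l'"
      have "\<not> (l, idx y) < (l', idx y')" "\<not> (l', idx y') < (l, idx y)"
        using * unfolding Bad_def Adj_def by (auto simp del: less_prod_simp)
      then have "(l, idx y) = (l', idx y')" by (meson linorder_less_linear)
      then show "y = y' \<and> l = l'" using idx * by (auto dest: inj_onD)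
    qed
    have "nbrs (G (d + N)) (v N) \<subseteq> (\<lambda>(y, l). rep d N y l) ` ?S"
    proof
      fix u assume u: "u \<in> nbrs (G (d + N)) (v N)"
      then have uV: "u \<in> verts (G (d + N))" using edge_verts[OF simple] by (auto simp: nbrs_def)
      \<comment> \<open>All descriptions of \<open>u\<close>, with the list first to match the
        lexicographic order; the minimum of \<open>P\<close> lies in \<open>Adj\<close> but not in
        \<open>Bad\<close>.\<close>
      define P where "P = (\<lambda>(y, l). (l, idx y)) ` {(y, l) \<in> ?V \<times> inc_lists d N. rep d N y l = u}"
      have "finite P"
        unfolding P_def
        by (intro finite_imageI finite_subset[OF _ finite_cartesian_product[OF finV finite_inc_lists[of d N]]]) auto
      moreover have "P \<noteq> {}" using rep_surj[OF stable N uV] by (auto simp: P_def)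
      ultimately have "Min P \<in> P" and min: "\<And>p. p \<in> P \<Longrightarrow> \<not> p < Min P"
        by (auto simp: not_less)
      then obtain y l where yl: "y \<in> ?V" "l \<in> inc_lists d N" "rep d N y l = u" "Min P = (l, idx y)"
        by (auto simp: P_def)
      have "l \<in> Adj y N" using u yl by (auto simp: Adj_def nbrs_def)
      moreover have "l \<notin> Bad y N"
      proof
        assume "l \<in> Bad y N"
        then obtain y' l' where "y' \<in> ?V" "l' \<in> inc_lists d N" "rep d N y' l' = u"
          and less: "(l', idx y') < Min P"
          using yl unfolding Bad_def by auto
        then have "(l', idx y') \<in> P" by (auto simp: P_def)
        with min less show False by blast
      qed
      ultimately show "u \<in> (\<lambda>(y, l). rep d N y l) ` ?S"
        using yl by (intro image_eqI[of _ _ "(y, l)"]) simp_all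
    qed
    moreover have "(\<lambda>(y, l). rep d N y l) ` ?S \<subseteq> nbrs (G (d + N)) (v N)"
      by (auto simp: Adj_def nbrs_def)
    ultimately have "nbrs (G (d + N)) (v N) = (\<lambda>(y, l). rep d N y l) ` ?S"
      by (rule equalityI)
    then have "vdegree (G (d + N)) (v N) = card ((\<lambda>(y, l). rep d N y l) ` ?S)"
      by (simp only: vdegree_eq_card_nbrs[OF simple])
    also have "\<dots> = card ?S" by (rule card_image[OF inj])
    also have "\<dots> = (\<Sum>y\<in>?V. card (Adj y N - Bad y N))"
      by (rule card_SigmaI) (simp_all add: finV Adj_def finite_inc_lists)
    finally have *: "vdegree (G (d + N)) (v N) = (\<Sum>y\<in>?V. card (Adj y N - Bad y N))" .
    have "of_nat (card (Adj y N - Bad y N)) = (of_nat (card (Adj y N)) - of_nat (card (Bad y N)) :: rat)" for y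
    proof -
      have fin: "finite (Adj y N)" and sub: "Bad y N \<subseteq> Adj y N"
        by (auto simp: Adj_def Bad_def finite_inc_lists simp del: less_prod_simp)
      show ?thesis
        using card_Diff_subset[OF finite_subset[OF sub fin] sub] card_mono[OF fin sub]
        by (simp add: of_nat_diff)
    qed
    then show ?thesis by (simp add: *)
  qed
  have "ev_poly (\<lambda>N. \<Sum>y\<in>?V. of_nat (card (Adj y N)) - of_nat (card (Bad y N))) d"
    by (intro ev_poly_sum ev_poly_diff ev_poly_card_skip_closed Adj Bad)
  from ev_poly_shift[OF this, of d] show ?thesis
    unfolding eventually_poly_iff
  proof (rule ev_poly_cong[rotated])
    show "\<forall>\<^sub>F n in sequentially. of_nat (vdegree (G n) (act d n (lift_map d d id) w)) =
      (\<Sum>y\<in>?V. of_nat (card (Adj y (n - d))) - of_nat (card (Bad y (n - d))) :: rat)"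
      \<comment> \<open>With \<open>N = n - d\<close>, the count requires
        \<open>d \<le> N\<close>.\<close>
      using eventually_ge_at_top[of "d + d"]
    proof eventually_elim
      case (elim n)
      then show ?case using deg[of "n - d"] by (simp add: v_def)
    qed
  qed
qed

text \<open>This indexes the degrees by a finite set that does not depend on
  \<open>n\<close>.\<close>

lemma vdegree_image:
  assumes "vertex_stable G act d" "d \<le> n"
  shows "vdegree (G n) ` verts (G n) =
    (\<lambda>w. vdegree (G n) (act d n (lift_map d d id) w)) ` verts (G d)"
proof (intro equalityI subsetI)
  fix k assume "k \<in> vdegree (G n) ` verts (G n)"
  then obtain u where u: "u \<in> verts (G n)" "k = vdegree (G n) u" by blast
  obtain w f where w: "w \<in> verts (G d)" "f \<in> fi_hom d n" "act d n f w = u"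
    using generated[OF assms u(1)] by blast
  show "k \<in> (\<lambda>w. vdegree (G n) (act d n (lift_map d d id) w)) ` verts (G d)"
    using vdegree_act_eq[OF w(2) incl_fi_hom[OF assms(2)] w(1)] w u by simp
qed (auto intro: act_verts[OF incl_fi_hom[OF assms(2)]])

end

theorem theorem3:
  fixes G :: "nat \<Rightarrow> 'a sgraph"
    and act :: "nat \<Rightarrow> nat \<Rightarrow> (nat \<Rightarrow> nat) \<Rightarrow> 'a \<Rightarrow> 'a"
    and d :: nat
  assumes "fi_graph G act"
    and "vertex_stable G act d"
  shows "eventually_poly (\<lambda>n. max_degree (G n)) d \<and> eventually_poly (\<lambda>n. min_degree (G n)) d"
proof -
  interpret fi_graph G act by fact
  define h where "h w n = vdegree (G n) (act d n (lift_map d d id) w)" for w n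
  have img: "vdegree (G n) ` verts (G n) = (\<lambda>w. h w n) ` verts (G d)" if "d \<le> n" for n
    using vdegree_image[OF assms(2) that] by (simp add: h_def)
  \<comment> \<open>From \<open>d\<close> on, either all graphs are empty and the default value 0
    applies throughout, or none is.\<close>
  then have empty: "verts (G n) = {} \<longleftrightarrow> verts (G d) = {}" if "d \<le> n" for n
    using that by (metis image_is_empty)
  show ?thesis
  proof (cases "verts (G d) = {}")
    case True
    have "\<forall>\<^sub>F n in sequentially. max_degree (G n) = 0" "\<forall>\<^sub>F n in sequentially. min_degree (G n) = 0"
      by (intro eventually_mono[OF eventually_ge_at_top[of d]];
          simp add: max_degree_def min_degree_def empty True)+
    moreover have "eventually_poly (\<lambda>_. 0) d" by (simp add: eventually_poly_iff ev_poly_const)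
    ultimately show ?thesis by (auto intro: eventually_poly_cong)
  next
    case False
    have "\<forall>\<^sub>F n in sequentially. max_degree (G n) = Max ((\<lambda>w. h w n) ` verts (G d))"
      "\<forall>\<^sub>F n in sequentially. min_degree (G n) = Min ((\<lambda>w. h w n) ` verts (G d))"
      by (intro eventually_mono[OF eventually_ge_at_top[of d]];
          simp add: max_degree_def min_degree_def empty img False)+
    moreover have "eventually_poly (\<lambda>n. Max ((\<lambda>w. h w n) ` verts (G d))) d \<and>
        eventually_poly (\<lambda>n. Min ((\<lambda>w. h w n) ` verts (G d))) d"
      using simple False eventually_poly_vdegree[OF assms(2)]
      by (intro eventually_poly_Max_Min) (auto simp: simple_graph_def h_def)
    ultimately show ?thesis by (auto intro: eventually_poly_cong)
  qed
qed

end
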